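(* Let $TeLU:\mathbb{R}\to\mathbb{R}$ be defined by $TeLU(x)=x\cdot\tanh(e^x)$. Then $TeLU$ is an analytic universal approximator, in the following sense: for every integer $n\ge 1$, all real numbers $a<b$, every continuous function $f:[a,b]^n\to\mathbb{R}$ and every $\epsilon>0$, there exist $M\in\mathbb{N}$, scalars $\alpha_1,\dots,\alpha_M\in\mathbb{R}$, vectors $w_1,\dots,w_M\in\mathbb{R}^n$ and biases $b_1,\dots,b_M\in\mathbb{R}$ such that the function $$g(x)=\sum_{j=1}^{M}\alpha_j\cdot TeLU(w_j^\intercal x+b_j)$$ satisfies $|g(x)-f(x)|<\epsilon$ for all $x\in[a,b]^n$, and every such $g$ is an analytic function.
   Context: A real function is called analytic if at every point $x_0$ of its domain it is equal, in a neighborhood of $x_0$, to a convergent power series centered at $x_0$ (in several real variables when $n>1$). *)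

theory Defs
  imports "HOL-Analysis.Analysis"
begin

definition TeLU :: "real \<Rightarrow> real" where
  "TeLU x = x * tanh (exp x)"

text \<open>The function computed by a network with one hidden layer of \<open>M\<close> units and
  activation function \<open>\<sigma>\<close>. Only the values of the parameters at the indices
  \<open>1, \<dots>, M\<close> matter.\<close>

definition shallow_net ::
  "(real \<Rightarrow> real) \<Rightarrow> nat \<Rightarrow> (nat \<Rightarrow> real) \<Rightarrow> (nat \<Rightarrow> real ^ 'n) \<Rightarrow> (nat \<Rightarrow> real) \<Rightarrow> real ^ 'n \<Rightarrow> real"
where
  "shallow_net \<sigma> M \<alpha> w \<beta> x = (\<Sum>j=1..M. \<alpha> j * \<sigma> (w j \<bullet> x + \<beta> j))"

text \<open>Real analyticity on the whole space. A power series in several variables is a sum over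
  all multi-indices \<open>k\<close>, taken in the sense of unconditional (equivalently, absolute)
  convergence, since multi-indices carry no canonical order.\<close>

definition real_analytic :: "(real ^ 'n \<Rightarrow> real) \<Rightarrow> bool" where
  "real_analytic g \<longleftrightarrow>
     (\<forall>x0. \<exists>c :: ('n \<Rightarrow> nat) \<Rightarrow> real. \<forall>\<^sub>F x in nhds x0.
        ((\<lambda>k. c k * (\<Prod>i\<in>UNIV. (x $ i - x0 $ i) ^ k i)) has_sum g x) UNIV)"

end

theory Submission
  imports Defs "HOL-Complex_Analysis.Cauchy_Integral_Formula"
begin

text \<open>Density: \<open>TeLU\<close> stays within bounded distance of the ReLU function \<open>max 0\<close>, so
  \<open>TeLU (c t) / c\<close> tends to \<open>max 0 t\<close> uniformly as \<open>c\<close> grows. Hence networks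
  approximate all piecewise linear, and therefore all continuous, functions of \<open>w \<bullet> x\<close>, in
  particular the exponentials \<open>exp (w \<bullet> x)\<close>, whose linear span is an algebra to which the
  Stone--Weierstrass theorem applies.

  Analyticity: \<open>TeLU\<close> extends holomorphically to a complex neighbourhood of the real line, so it
  has a power series at every real point. Substituting \<open>\<Sum>i. w\<^sub>i y\<^sub>i\<close> into it
  and expanding each power over lists of indices gives an absolutely convergent sum over all lists,
  which is regrouped by the number of occurrences of each index.\<close>

section \<open>Multinomial expansion of a power series, summed over lists of indices\<close>

lemma prod_list_map_eq_prod_count:
  fixes z :: "'n::finite \<Rightarrow> 'a::comm_monoid_mult"
  shows "prod_list (map z xs) = (\<Prod>i\<in>UNIV. z i ^ count_list xs i)"
proof (induction xs)
  case (Cons x xs)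
  have "(\<Prod>i\<in>UNIV. z i ^ count_list (x # xs) i)
      = (\<Prod>i\<in>UNIV. (if i = x then z i else 1) * z i ^ count_list xs i)"
    by (intro prod.cong) auto
  also have "\<dots> = z x * (\<Prod>i\<in>UNIV. z i ^ count_list xs i)"
    by (simp add: prod.distrib)
  finally show ?case
    using Cons.IH by simp
qed simp

text \<open>The multinomial theorem before like terms are collected: a list records which summand is
  picked from each of the \<open>m\<close> factors, and splitting off its head peels off one
  factor.\<close>

lemma sum_prod_list_length_eq:
  fixes z :: "'n::finite \<Rightarrow> 'a::comm_semiring_1"
  shows "(\<Sum>xs | length xs = m. prod_list (map z xs)) = (\<Sum>i\<in>UNIV. z i) ^ m"
proof (induction m)
  case (Suc m)
  have "(\<Sum>xs | length xs = Suc m. prod_list (map z xs))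
      = (\<Sum>(x, xs)\<in>UNIV \<times> {xs. length xs = m}. z x * prod_list (map z xs))"
    by (rule sum.reindex_bij_witness[where i = "\<lambda>(x, xs). x # xs" and j = "\<lambda>xs. (hd xs, tl xs)"])
      (auto simp: length_Suc_conv)
  also have "\<dots> = (\<Sum>i\<in>UNIV. z i) * (\<Sum>xs | length xs = m. prod_list (map z xs))"
    by (simp add: sum_product sum.cartesian_product)
  finally show ?case
    using Suc.IH by simp
qed simp

text \<open>Unconditional sums may be taken block by block: \<open>x\<close> corresponds to the pair
  \<open>(p x, x)\<close>, so the index set is the disjoint union of the fibres of
  \<open>p\<close>.\<close>

lemma has_sum_fibres:
  fixes f :: "'a \<Rightarrow> 'c :: {topological_comm_monoid_add,t3_space}"
  assumes "(f has_sum s) UNIV" "\<And>k. (f has_sum b k) {x. p x = k}"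
  shows "(b has_sum s) UNIV"
proof (rule has_sum_SigmaD)
  show "((\<lambda>(k, x). f x) has_sum s) (Sigma UNIV (\<lambda>k. {x. p x = k}))"
    using assms(1)
    by (rule has_sum_reindex_bij_witness[where i = snd and j = "\<lambda>x. (p x, x)", THEN iffD1, rotated -1]) auto
qed (use assms(2) in auto)

text \<open>Convergence is required at the sum of the \<open>\<bar>z i\<bar>\<close> because
  cancellation between the \<open>z i\<close> is lost once the terms of each power are separated.
  The cardinality in the coefficient is the multinomial coefficient; it never has to be
  computed.\<close>

lemma has_sum_power_of_sum:
  fixes z :: "'n::finite \<Rightarrow> real"
  assumes sums: "(\<lambda>m. a m * (\<Sum>i\<in>UNIV. z i) ^ m) sums s"
    and abs: "summable (\<lambda>m. \<bar>a m\<bar> * (\<Sum>i\<in>UNIV. \<bar>z i\<bar>) ^ m)"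
  shows "((\<lambda>k. a (\<Sum>i\<in>UNIV. k i) * real (card {xs. count_list xs = k}) *
           (\<Prod>i\<in>UNIV. z i ^ k i)) has_sum s) UNIV"
proof (rule has_sum_fibres[where p = count_list])
  define f where "f xs = a (length xs) * prod_list (map z xs)" for xs :: "'n list"
  have fin: "finite {xs :: 'n list. length xs = m}" for m
    using finite_lists_length_eq[of "UNIV :: 'n set" m] by simp
  have abs_f: "\<bar>f xs\<bar> = \<bar>a (length xs)\<bar> * prod_list (map (\<lambda>i. \<bar>z i\<bar>) xs)" for xs
    by (simp add: f_def abs_mult prod_list_map_eq_prod_count abs_prod power_abs)
  have sum_f: "((\<lambda>xs. f xs) has_sum a m * (\<Sum>i\<in>UNIV. z i) ^ m) {xs. length xs = m}" for m
    by (rule has_sum_finiteI[OF fin])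
      (simp add: f_def sum_prod_list_length_eq flip: sum_distrib_left)
  have sum_abs_f: "((\<lambda>xs. \<bar>f xs\<bar>) has_sum \<bar>a m\<bar> * (\<Sum>i\<in>UNIV. \<bar>z i\<bar>) ^ m) {xs. length xs = m}" for m
    by (rule has_sum_finiteI[OF fin])
      (simp add: abs_f sum_prod_list_length_eq flip: sum_distrib_left)
  \<comment> \<open>Lists are first grouped by length: the absolute values within one length add up
    to a term of the series in \<open>abs\<close>.\<close>
  have "(\<lambda>(m, xs). \<bar>f xs\<bar>) summable_on Sigma UNIV (\<lambda>m. {xs. length xs = m})"
    using abs by (intro summable_on_SigmaI[where g = "\<lambda>m. \<bar>a m\<bar> * (\<Sum>i\<in>UNIV. \<bar>z i\<bar>) ^ m"])
      (auto intro!: sum_abs_f summable_nonneg_imp_summable_on mult_nonneg_nonneg sum_nonneg)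
  then have "(\<lambda>(m, xs). f xs) summable_on Sigma UNIV (\<lambda>m. {xs. length xs = m})"
    by (subst summable_on_iff_abs_summable_on_real) (simp add: case_prod_unfold)
  moreover have "((\<lambda>m. a m * (\<Sum>i\<in>UNIV. z i) ^ m) has_sum s) UNIV"
  proof (rule norm_summable_imp_has_sum[OF _ sums])
    have "\<bar>\<Sum>i\<in>UNIV. z i\<bar> \<le> (\<Sum>i\<in>UNIV. \<bar>z i\<bar>)"
      by (rule sum_abs)
    then show "summable (\<lambda>m. norm (a m * (\<Sum>i\<in>UNIV. z i) ^ m))"
      by (intro summable_comparison_test'[OF abs])
        (auto simp: abs_mult power_abs intro!: mult_left_mono power_mono)
  qed
  ultimately have "((\<lambda>(m, xs). f xs) has_sum s) (Sigma UNIV (\<lambda>m. {xs. length xs = m}))"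
    by (intro has_sum_SigmaI[where g = "\<lambda>m. a m * (\<Sum>i\<in>UNIV. z i) ^ m"]) (auto intro: sum_f)
  then show "(f has_sum s) UNIV"
    by (rule has_sum_reindex_bij_witness[where j = snd and i = "\<lambda>x. (length x, x)", THEN iffD1, rotated -1]) auto
  fix k :: "'n \<Rightarrow> nat"
  \<comment> \<open>The counts of a list add up to its length, so a fibre of
    \<open>count_list\<close> lies within a single length. It is therefore finite, and
    \<open>f\<close> is constant on it.\<close>
  have len: "length xs = (\<Sum>i\<in>UNIV. k i)" if "count_list xs = k" for xs
    using that sum_count_set[of xs UNIV] by auto
  then have "finite {xs. count_list xs = k}"
    by (intro finite_subset[OF _ fin[of "\<Sum>i\<in>UNIV. k i"]]) auto
  then show "(f has_sum a (\<Sum>i\<in>UNIV. k i) * real (card {xs. count_list xs = k}) *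
           (\<Prod>i\<in>UNIV. z i ^ k i)) {xs. count_list xs = k}"
    by (rule has_sum_finiteI) (simp add: f_def len prod_list_map_eq_prod_count)
qed

section \<open>Real analyticity of ridge functions and of networks\<close>

lemma power_series_imp_real_analytic_ridge:
  fixes w :: "real ^ 'n"
  assumes "\<And>t. \<exists>r>0. \<exists>a. \<forall>h. \<bar>h\<bar> < r \<longrightarrow> (\<lambda>m. a m * h ^ m) sums \<sigma> (t + h)"
  shows "real_analytic (\<lambda>x. \<sigma> (w \<bullet> x + \<beta>))"
  unfolding real_analytic_def
proof
  fix x0 :: "real ^ 'n"
  obtain r a where r: "r > 0"
    and a: "\<And>h. \<bar>h\<bar> < r \<Longrightarrow> (\<lambda>m. a m * h ^ m) sums \<sigma> (w \<bullet> x0 + \<beta> + h)"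
    using assms by metis
  define c where "c k = a (\<Sum>i\<in>UNIV. k i) * real (card {xs. count_list xs = k}) *
    (\<Prod>i\<in>UNIV. (w $ i) ^ k i)" for k
  \<comment> \<open>The neighbourhood of \<open>x0\<close> is cut out by this weighted sum of
    absolute values instead of the norm. It is continuous and vanishes at \<open>x0\<close>, and its
    being below \<open>r\<close> is exactly what the expansion over lists needs.\<close>
  have "((\<lambda>x. \<Sum>i\<in>UNIV. \<bar>w $ i * (x $ i - x0 $ i)\<bar>) \<longlongrightarrow> (\<Sum>i\<in>UNIV. \<bar>w $ i * (x0 $ i - x0 $ i)\<bar>)) (nhds x0)"
    by (intro tendsto_intros) (simp add: filterlim_ident)
  then have "\<forall>\<^sub>F x in nhds x0. (\<Sum>i\<in>UNIV. \<bar>w $ i * (x $ i - x0 $ i)\<bar>) < r"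
    using r by (intro order_tendstoD) auto
  then have "\<forall>\<^sub>F x in nhds x0.
    ((\<lambda>k. c k * (\<Prod>i\<in>UNIV. (x $ i - x0 $ i) ^ k i)) has_sum \<sigma> (w \<bullet> x + \<beta>)) UNIV"
  proof eventually_elim
    case (elim x)
    define z where "z i = w $ i * (x $ i - x0 $ i)" for i
    \<comment> \<open>A power series converges absolutely strictly inside any point of convergence;
      \<open>\<rho>\<close> leaves room for such a point below \<open>r\<close>.\<close>
    obtain \<rho> where \<rho>: "(\<Sum>i\<in>UNIV. \<bar>z i\<bar>) < \<rho>" "\<rho> < r"
      using elim dense unfolding z_def by blast
    moreover have "0 < \<rho>"
      using \<rho>(1) sum_abs_ge_zero[of z UNIV] by linarith
    ultimately have "summable (\<lambda>m. norm (a m * (\<Sum>i\<in>UNIV. \<bar>z i\<bar>) ^ m))"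
      by (intro powser_insidea[where x = \<rho>] sums_summable[OF a]) auto
    then have abs: "summable (\<lambda>m. \<bar>a m\<bar> * (\<Sum>i\<in>UNIV. \<bar>z i\<bar>) ^ m)"
      by (simp add: abs_mult power_abs)
    have "\<bar>\<Sum>i\<in>UNIV. z i\<bar> < r"
      using \<rho> sum_abs[of z UNIV] by linarith
    moreover have "(\<Sum>i\<in>UNIV. z i) = w \<bullet> x - w \<bullet> x0"
      by (simp add: z_def inner_vec_def right_diff_distrib sum_subtractf)
    ultimately have "(\<lambda>m. a m * (\<Sum>i\<in>UNIV. z i) ^ m) sums \<sigma> (w \<bullet> x + \<beta>)"
      using a[of "\<Sum>i\<in>UNIV. z i"] by (simp add: algebra_simps)
    from has_sum_power_of_sum[OF this abs] show ?case
      by (simp add: c_def z_def power_mult_distrib prod.distrib mult.assoc)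
  qed
  then show "\<exists>c. \<forall>\<^sub>F x in nhds x0.
    ((\<lambda>k. c k * (\<Prod>i\<in>UNIV. (x $ i - x0 $ i) ^ k i)) has_sum \<sigma> (w \<bullet> x + \<beta>)) UNIV"
    by blast
qed

lemma real_analytic_const_0: "real_analytic (\<lambda>x. 0)"
  unfolding real_analytic_def by (intro allI exI[of _ "\<lambda>_. 0"]) auto

lemma real_analytic_add:
  assumes "real_analytic f" "real_analytic g"
  shows "real_analytic (\<lambda>x. f x + g x)"
  unfolding real_analytic_def
proof
  fix x0
  obtain c where c:
    "\<forall>\<^sub>F x in nhds x0. ((\<lambda>k. c k * (\<Prod>i\<in>UNIV. (x $ i - x0 $ i) ^ k i)) has_sum f x) UNIV"
    using assms(1)[unfolded real_analytic_def, rule_format, of x0] by (rule exE)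
  obtain d where d:
    "\<forall>\<^sub>F x in nhds x0. ((\<lambda>k. d k * (\<Prod>i\<in>UNIV. (x $ i - x0 $ i) ^ k i)) has_sum g x) UNIV"
    using assms(2)[unfolded real_analytic_def, rule_format, of x0] by (rule exE)
  from c d have "\<forall>\<^sub>F x in nhds x0.
      ((\<lambda>k. (c k + d k) * (\<Prod>i\<in>UNIV. (x $ i - x0 $ i) ^ k i)) has_sum f x + g x) UNIV"
    by eventually_elim (auto simp: distrib_right intro: has_sum_add)
  then show "\<exists>c. \<forall>\<^sub>F x in nhds x0.
      ((\<lambda>k. c k * (\<Prod>i\<in>UNIV. (x $ i - x0 $ i) ^ k i)) has_sum f x + g x) UNIV"
    by (rule exI[where x = "\<lambda>k. c k + d k"])
qed

lemma real_analytic_cmult: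
  assumes "real_analytic f"
  shows "real_analytic (\<lambda>x. r * f x)"
  unfolding real_analytic_def
proof
  fix x0
  obtain c where
    "\<forall>\<^sub>F x in nhds x0. ((\<lambda>k. c k * (\<Prod>i\<in>UNIV. (x $ i - x0 $ i) ^ k i)) has_sum f x) UNIV"
    using assms[unfolded real_analytic_def, rule_format, of x0] by (rule exE)
  then have "\<forall>\<^sub>F x in nhds x0.
      ((\<lambda>k. (r * c k) * (\<Prod>i\<in>UNIV. (x $ i - x0 $ i) ^ k i)) has_sum r * f x) UNIV"
    by eventually_elim (auto simp: mult.assoc intro: has_sum_cmult_right)
  then show "\<exists>c. \<forall>\<^sub>F x in nhds x0.
      ((\<lambda>k. c k * (\<Prod>i\<in>UNIV. (x $ i - x0 $ i) ^ k i)) has_sum r * f x) UNIV"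
    by (rule exI[where x = "\<lambda>k. r * c k"])
qed

lemma real_analytic_sum:
  assumes "\<And>j. j \<in> J \<Longrightarrow> real_analytic (f j)"
  shows "real_analytic (\<lambda>x. \<Sum>j\<in>J. f j x)"
  using assms
  by (induction J rule: infinite_finite_induct) (auto intro: real_analytic_const_0 real_analytic_add)

text \<open>The real series is the real part of the complex Taylor series: for real \<open>h\<close>
  the factor \<open>h ^ m\<close> comes out of \<open>Re\<close>, and \<open>F\<close> takes the
  values of \<open>\<phi>\<close> on the real line.\<close>

lemma holomorphic_extension_imp_power_series:
  assumes "F analytic_on {of_real t}" "\<And>s. F (of_real s) = of_real (\<phi> s)"
  shows "\<exists>r>0. \<exists>a. \<forall>h. \<bar>h\<bar> < r \<longrightarrow> (\<lambda>m. a m * h ^ m) sums \<phi> (t + h)"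
proof -
  obtain r where r: "r > 0" "F holomorphic_on ball (of_real t) r"
    using assms(1) by (auto simp: analytic_on_def)
  define a where "a m = (deriv ^^ m) F (of_real t) / fact m" for m
  have "(\<lambda>m. Re (a m) * h ^ m) sums \<phi> (t + h)" if "\<bar>h\<bar> < r" for h
  proof -
    have "(\<lambda>m. a m * of_real h ^ m) sums F (of_real (t + h))"
      using holomorphic_power_series[OF r(2), of "of_real (t + h)"] that
      by (simp add: a_def dist_norm)
    then have "(\<lambda>m. Re (a m * of_real h ^ m)) sums \<phi> (t + h)"
      unfolding assms(2) by (auto dest: sums_Re)
    then show ?thesis
      by (simp flip: of_real_power)
  qed
  with r(1) show ?thesis
    by (intro exI[of _ r] conjI exI[of _ "\<lambda>m. Re (a m)"]) auto
qed

lemma TeLU_power_series: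
  "\<exists>r>0. \<exists>a. \<forall>h. \<bar>h\<bar> < r \<longrightarrow> (\<lambda>m. a m * h ^ m) sums TeLU (t + h)"
proof (rule holomorphic_extension_imp_power_series)
  have cosh: "cosh (complex_of_real s) = of_real (cosh s)" for s
    by (simp add: cosh_def exp_of_real scaleR_conv_of_real flip: of_real_minus)
  have sinh: "sinh (complex_of_real s) = of_real (sinh s)" for s
    by (simp add: sinh_def exp_of_real scaleR_conv_of_real flip: of_real_minus)
  \<comment> \<open>The only possible singularities are zeros of \<open>cosh (exp z)\<close>, and
    \<open>cosh\<close> is positive at the real number \<open>exp t\<close>.\<close>
  show "(\<lambda>z. z * tanh (exp z)) analytic_on {complex_of_real t}"
    by (intro analytic_intros) (simp add: exp_of_real cosh)
  show "complex_of_real s * tanh (exp (of_real s)) = of_real (TeLU s)" for s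
    by (simp add: TeLU_def exp_of_real tanh_def cosh sinh)
qed

lemma real_analytic_shallow_net_TeLU: "real_analytic (shallow_net TeLU M \<alpha> w \<beta>)"
  unfolding shallow_net_def
  by (intro real_analytic_sum real_analytic_cmult power_series_imp_real_analytic_ridge TeLU_power_series)

section \<open>Closure properties of uniform approximability\<close>

definition approximable ::
  "(real \<Rightarrow> real) \<Rightarrow> (real ^ 'n) set \<Rightarrow> (real ^ 'n \<Rightarrow> real) \<Rightarrow> bool"
where
  "approximable \<sigma> K f \<longleftrightarrow>
     (\<forall>\<epsilon>>0. \<exists>M \<alpha> w \<beta>. \<forall>x\<in>K. \<bar>shallow_net \<sigma> M \<alpha> w \<beta> x - f x\<bar> < \<epsilon>)"

lemma shallow_net_unit: "shallow_net \<sigma> 1 (\<lambda>_. c) (\<lambda>_. w) (\<lambda>_. b) x = c * \<sigma> (w \<bullet> x + b)"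
  by (simp add: shallow_net_def)

lemma shallow_net_add:
  "\<exists>\<alpha> w \<beta>. \<forall>x. shallow_net \<sigma> (M + N) \<alpha> w \<beta> x
     = shallow_net \<sigma> M \<alpha>1 w1 \<beta>1 x + shallow_net \<sigma> N \<alpha>2 w2 \<beta>2 x"
proof -
  \<comment> \<open>The hidden layers are concatenated: units \<open>1..M\<close> come from the
    first network, and unit \<open>M + j\<close> is unit \<open>j\<close> of the second.\<close>
  have "shallow_net \<sigma> (M + N) (\<lambda>j. if j \<le> M then \<alpha>1 j else \<alpha>2 (j - M))
     (\<lambda>j. if j \<le> M then w1 j else w2 (j - M)) (\<lambda>j. if j \<le> M then \<beta>1 j else \<beta>2 (j - M)) x
     = shallow_net \<sigma> M \<alpha>1 w1 \<beta>1 x + shallow_net \<sigma> N \<alpha>2 w2 \<beta>2 x" for x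
    by (induction N) (simp_all add: shallow_net_def)
  then show ?thesis
    by blast
qed

lemma shallow_net_cmult:
  "c * shallow_net \<sigma> M \<alpha> w \<beta> x = shallow_net \<sigma> M (\<lambda>j. c * \<alpha> j) w \<beta> x"
  by (simp add: shallow_net_def sum_distrib_left mult.assoc)

lemma approximable_unit: "approximable \<sigma> K (\<lambda>x. c * \<sigma> (w \<bullet> x + b))"
  unfolding approximable_def
proof (intro allI impI)
  fix \<epsilon> :: real
  assume "\<epsilon> > 0"
  then have "\<forall>x\<in>K. \<bar>shallow_net \<sigma> 1 (\<lambda>_. c) (\<lambda>_. w) (\<lambda>_. b) x - c * \<sigma> (w \<bullet> x + b)\<bar> < \<epsilon>"
    unfolding shallow_net_unit by simp
  then show "\<exists>M \<alpha> w' \<beta>. \<forall>x\<in>K. \<bar>shallow_net \<sigma> M \<alpha> w' \<beta> x - c * \<sigma> (w \<bullet> x + b)\<bar> < \<epsilon>"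
    by blast
qed

lemma approximable_add:
  assumes "approximable \<sigma> K f" "approximable \<sigma> K g"
  shows "approximable \<sigma> K (\<lambda>x. f x + g x)"
  unfolding approximable_def
proof (intro allI impI)
  fix \<epsilon> :: real
  assume "\<epsilon> > 0"
  then have "\<epsilon> / 2 > 0"
    by simp
  obtain M \<alpha> w \<beta> where f: "\<forall>x\<in>K. \<bar>shallow_net \<sigma> M \<alpha> w \<beta> x - f x\<bar> < \<epsilon> / 2"
    using assms(1) \<open>\<epsilon> / 2 > 0\<close> unfolding approximable_def by blast
  obtain N \<alpha>' w' \<beta>' where g: "\<forall>x\<in>K. \<bar>shallow_net \<sigma> N \<alpha>' w' \<beta>' x - g x\<bar> < \<epsilon> / 2"
    using assms(2) \<open>\<epsilon> / 2 > 0\<close> unfolding approximable_def by blast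
  obtain \<alpha>'' w'' \<beta>'' where "\<forall>x. shallow_net \<sigma> (M + N) \<alpha>'' w'' \<beta>'' x
     = shallow_net \<sigma> M \<alpha> w \<beta> x + shallow_net \<sigma> N \<alpha>' w' \<beta>' x"
    using shallow_net_add by blast
  with f g have "\<bar>shallow_net \<sigma> (M + N) \<alpha>'' w'' \<beta>'' x - (f x + g x)\<bar> < \<epsilon>" if "x \<in> K" for x
    using that by (smt (verit) field_sum_of_halves)
  then show "\<exists>M \<alpha> w \<beta>. \<forall>x\<in>K. \<bar>shallow_net \<sigma> M \<alpha> w \<beta> x - (f x + g x)\<bar> < \<epsilon>"
    by blast
qed

lemma approximable_cmult:
  assumes "approximable \<sigma> K f"
  shows "approximable \<sigma> K (\<lambda>x. c * f x)"
  unfolding approximable_def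
proof (intro allI impI)
  fix \<epsilon> :: real
  assume "\<epsilon> > 0"
  \<comment> \<open>Adding 1 covers \<open>c = 0\<close> and makes the final inequality
    strict.\<close>
  then have "\<epsilon> / (\<bar>c\<bar> + 1) > 0"
    by simp
  then obtain M \<alpha> w \<beta> where *: "\<forall>x\<in>K. \<bar>shallow_net \<sigma> M \<alpha> w \<beta> x - f x\<bar> < \<epsilon> / (\<bar>c\<bar> + 1)"
    using assms unfolding approximable_def by blast
  have "\<bar>c * shallow_net \<sigma> M \<alpha> w \<beta> x - c * f x\<bar> < \<epsilon>" if "x \<in> K" for x
  proof -
    have "\<bar>c * shallow_net \<sigma> M \<alpha> w \<beta> x - c * f x\<bar> = \<bar>c\<bar> * \<bar>shallow_net \<sigma> M \<alpha> w \<beta> x - f x\<bar>"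
      by (simp add: abs_mult flip: right_diff_distrib)
    also have "\<dots> \<le> \<bar>c\<bar> * (\<epsilon> / (\<bar>c\<bar> + 1))"
      using * that by (intro mult_left_mono) (auto intro: less_imp_le)
    also have "\<dots> < \<epsilon>"
      using \<open>\<epsilon> > 0\<close> by (simp add: field_simps)
    finally show ?thesis .
  qed
  then show "\<exists>M \<alpha> w \<beta>. \<forall>x\<in>K. \<bar>shallow_net \<sigma> M \<alpha> w \<beta> x - c * f x\<bar> < \<epsilon>"
    unfolding shallow_net_cmult by blast
qed

text \<open>Allows approximations to be chained: ReLU by single units, ridge functions by
  interpolants, continuous functions by exponential sums.\<close>

lemma approximable_closed:
  assumes "\<And>\<epsilon>. \<epsilon> > 0 \<Longrightarrow> \<exists>g. approximable \<sigma> K g \<and> (\<forall>x\<in>K. \<bar>g x - f x\<bar> \<le> \<epsilon>)"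
  shows "approximable \<sigma> K f"
  unfolding approximable_def
proof (intro allI impI)
  fix \<epsilon> :: real
  assume "\<epsilon> > 0"
  then have "\<epsilon> / 2 > 0"
    by simp
  obtain g where g: "approximable \<sigma> K g" "\<forall>x\<in>K. \<bar>g x - f x\<bar> \<le> \<epsilon> / 2"
    using assms \<open>\<epsilon> / 2 > 0\<close> by blast
  obtain M \<alpha> w \<beta> where "\<forall>x\<in>K. \<bar>shallow_net \<sigma> M \<alpha> w \<beta> x - g x\<bar> < \<epsilon> / 2"
    using g(1) \<open>\<epsilon> / 2 > 0\<close> unfolding approximable_def by blast
  with g(2) have "\<bar>shallow_net \<sigma> M \<alpha> w \<beta> x - f x\<bar> < \<epsilon>" if "x \<in> K" for x
    using that by (smt (verit) field_sum_of_halves)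
  then show "\<exists>M \<alpha> w \<beta>. \<forall>x\<in>K. \<bar>shallow_net \<sigma> M \<alpha> w \<beta> x - f x\<bar> < \<epsilon>"
    by blast
qed

section \<open>From \<open>TeLU\<close> to ReLU, and from ReLU to continuous ridge functions\<close>

lemma TeLU_near_relu: "\<bar>TeLU x - max 0 x\<bar> \<le> 2"
proof -
  define y where "y = exp x"
  have y: "y > 0" "1 + x \<le> y"
    by (auto simp: y_def)
  define e where "e = exp (- 2 * y)"
  have e: "e > 0" "e < 1"
    using y by (auto simp: e_def)
  have tanh: "tanh y = (1 - e) / (1 + e)"
    unfolding e_def by (rule tanh_real_altdef)
  show ?thesis
  proof (cases "x \<ge> 0")
    case True
    \<comment> \<open>On the right the error is \<open>x * (1 - tanh y)\<close>, at most
      \<open>2 * x * e\<close>; since \<open>x\<close> is below \<open>exp (2 * y)\<close>, the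
      reciprocal of \<open>e\<close>, this is at most 2.\<close>
    have "1 - tanh y = 2 * e / (1 + e)"
      using e by (simp add: tanh field_simps)
    also have "\<dots> \<le> 2 * e"
      using e by (simp add: field_simps)
    finally have *: "1 - tanh y \<le> 2 * e" .
    have "x * e \<le> 1"
    proof -
      have "x \<le> exp (2 * y)"
        using exp_ge_add_one_self[of "2 * y"] y by linarith
      then have "x * e \<le> exp (2 * y) * e"
        using e by (intro mult_right_mono) auto
      also have "\<dots> = 1"
        by (simp add: e_def flip: exp_add)
      finally show ?thesis .
    qed
    have "x * (1 - tanh y) \<le> x * (2 * e)"
      using * True by (intro mult_left_mono)
    moreover have "0 \<le> x * (1 - tanh y)"
      using True tanh_real_lt_1[of y] by (intro mult_nonneg_nonneg) auto
    ultimately show ?thesis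
      using True \<open>x * e \<le> 1\<close> by (simp add: TeLU_def flip: y_def) (simp add: algebra_simps)
  next
    case False
    \<comment> \<open>On the left the error is \<open>- x * tanh y\<close>. Here
      \<open>tanh y\<close> is at most \<open>2 * y\<close>, and \<open>- x * exp x\<close> is at
      most 1, so the exponential decay of \<open>y\<close> absorbs the linear factor.\<close>
    have "tanh y \<le> 1 - e"
      using e by (simp add: tanh field_simps)
    also have "\<dots> \<le> 2 * y"
      using exp_ge_add_one_self[of "- 2 * y"] by (simp add: e_def)
    finally have "- x * tanh y \<le> - x * (2 * y)"
      using False by (intro mult_left_mono) auto
    also have "- x * y \<le> exp (- x) * y"
      using exp_ge_add_one_self[of "- x"] y by (intro mult_right_mono) linarith+
    then have "- x * (2 * y) \<le> 2"
      by (simp add: y_def flip: exp_add)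
    finally have "- x * tanh y \<le> 2" .
    moreover have "0 \<le> - x * tanh y"
      using False y by (intro mult_nonneg_nonneg) auto
    ultimately show ?thesis
      using False by (simp add: TeLU_def flip: y_def)
  qed
qed

lemma approximable_relu: "approximable TeLU K (\<lambda>x. max 0 (w \<bullet> x + b))"
proof (rule approximable_closed)
  fix \<epsilon> :: real
  assume "\<epsilon> > 0"
  \<comment> \<open>\<open>max 0\<close> is positively homogeneous, so rescaling by \<open>c\<close>
    shrinks the error bound 2 to \<open>2 / c\<close>, which this choice makes equal to
    \<epsilon>.\<close>
  define c where "c = 2 / \<epsilon>"
  have c: "c > 0"
    using \<open>\<epsilon> > 0\<close> by (simp add: c_def)
  have approx: "\<bar>(1 / c) * TeLU ((c *\<^sub>R w) \<bullet> x + c * b) - max 0 (w \<bullet> x + b)\<bar> \<le> \<epsilon>" for x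
  proof -
    define t where "t = w \<bullet> x + b"
    have "(1 / c) * TeLU (c * t) - max 0 t = (1 / c) * (TeLU (c * t) - max 0 (c * t))"
      using c by (auto simp: max_def field_simps zero_le_mult_iff)
    then have "\<bar>(1 / c) * TeLU (c * t) - max 0 t\<bar> \<le> (1 / c) * 2"
      using TeLU_near_relu[of "c * t"] c by (simp add: abs_mult divide_right_mono)
    then show ?thesis
      using \<open>\<epsilon> > 0\<close> by (simp add: t_def c_def distrib_left)
  qed
  show "\<exists>g. approximable TeLU K g \<and> (\<forall>x\<in>K. \<bar>g x - max 0 (w \<bullet> x + b)\<bar> \<le> \<epsilon>)"
    using approximable_unit[of TeLU K "1 / c" "c *\<^sub>R w" "c * b"] approx by blast
qed

lemma approximable_const: "approximable TeLU K (\<lambda>x. c)"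
proof -
  \<comment> \<open>A constant is a unit with weight vector 0, normalised at a bias where
    \<open>TeLU\<close> does not vanish.\<close>
  have "TeLU 1 > 0"
    by (simp add: TeLU_def)
  then show ?thesis
    using approximable_unit[of TeLU K "c / TeLU 1" 0 1] by simp
qed

text \<open>The witness \<open>g\<close> is the piecewise linear interpolant of \<open>h\<close> at the nodes \<open>A + k d\<close> for \<open>k \<le> N\<close>,
  continued by a constant beyond the last node so that the induction on \<open>N\<close> closes.\<close>

lemma approximable_interpolant:
  fixes h :: "real \<Rightarrow> real"
  assumes "d > 0"
    and osc: "\<And>k t. k < N \<Longrightarrow> A + real k * d \<le> t \<Longrightarrow> t \<le> A + real (Suc k) * d \<Longrightarrow>
      \<bar>h t - h (A + real k * d)\<bar> \<le> \<epsilon>"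
    and "\<epsilon> \<ge> 0"
  shows "\<exists>g. approximable TeLU K (\<lambda>x. g (w \<bullet> x)) \<and>
    (\<forall>t. A \<le> t \<longrightarrow> t \<le> A + real N * d \<longrightarrow> \<bar>g t - h t\<bar> \<le> 2 * \<epsilon>) \<and>
    (\<forall>t. A + real N * d \<le> t \<longrightarrow> g t = h (A + real N * d))"
  using osc
proof (induction N)
  case 0
  show ?case
    using \<open>\<epsilon> \<ge> 0\<close> by (intro exI[of _ "\<lambda>_. h A"]) (auto simp: approximable_const)
next
  case (Suc N)
  define s where "s = A + real N * d"
  have s': "A + real (Suc N) * d = s + d"
    by (simp add: s_def algebra_simps)
  obtain g where g: "approximable TeLU K (\<lambda>x. g (w \<bullet> x))"
    "\<And>t. A \<le> t \<Longrightarrow> t \<le> s \<Longrightarrow> \<bar>g t - h t\<bar> \<le> 2 * \<epsilon>" "\<And>t. s \<le> t \<Longrightarrow> g t = h s"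
    using Suc.IH Suc.prems unfolding s_def by (metis less_SucI)
  have osc: "\<bar>h t - h s\<bar> \<le> \<epsilon>" if "s \<le> t" "t \<le> s + d" for t
    using Suc.prems[of N t] that by (simp add: s' s_def[symmetric] del: of_nat_Suc)
  define D where "D = h (s + d) - h s"
  \<comment> \<open>Two ReLUs give a ramp rising from 0 at \<open>s\<close> to 1 at
    \<open>s + d\<close>. Adding \<open>D\<close> times it leaves \<open>g\<close> alone up to
    \<open>s\<close> and moves the constant tail from \<open>h s\<close> to
    \<open>h (s + d)\<close>.\<close>
  define ramp where "ramp t = (max 0 (t - s) - max 0 (t - (s + d))) / d" for t
  define g' where "g' t = g t + D * ramp t" for t
  have ramp_0: "ramp t = 0" if "t \<le> s" for t
    using that \<open>d > 0\<close> by (simp add: ramp_def)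
  have ramp_1: "ramp t = 1" if "s + d \<le> t" for t
    using that \<open>d > 0\<close> by (simp add: ramp_def)
  have ramp_bounds: "\<bar>ramp t\<bar> \<le> 1" for t
    using \<open>d > 0\<close> by (auto simp: ramp_def max_def)
  have "approximable TeLU K (\<lambda>x. g (w \<bullet> x) +
    ((D / d) * max 0 (w \<bullet> x + (- s)) + (- D / d) * max 0 (w \<bullet> x + (- s - d))))"
    by (intro approximable_add approximable_cmult g approximable_relu)
  also have "(\<lambda>x. g (w \<bullet> x) +
    ((D / d) * max 0 (w \<bullet> x + (- s)) + (- D / d) * max 0 (w \<bullet> x + (- s - d)))) = (\<lambda>x. g' (w \<bullet> x))"
    by (simp add: g'_def ramp_def diff_divide_distrib algebra_simps)
  finally have "approximable TeLU K (\<lambda>x. g' (w \<bullet> x))" .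
  moreover have "\<bar>g' t - h t\<bar> \<le> 2 * \<epsilon>" if "A \<le> t" "t \<le> s + d" for t
  proof (cases "t \<le> s")
    case True
    then show ?thesis
      using g(2) that by (simp add: g'_def ramp_0)
  next
    case False
    \<comment> \<open>On the new cell both \<open>g' t\<close> and \<open>h t\<close> stay within
      \<epsilon> of \<open>h s\<close>, hence the factor 2 in the claim.\<close>
    have "\<bar>D * ramp t\<bar> \<le> \<epsilon> * 1"
      unfolding abs_mult using ramp_bounds osc[of "s + d"] \<open>d > 0\<close> \<open>\<epsilon> \<ge> 0\<close>
      by (intro mult_mono) (auto simp: D_def)
    then show ?thesis
      using False that osc[of t] g(3)[of t] by (simp add: g'_def)
  qed
  moreover have "g' t = h (s + d)" if "s + d \<le> t" for t
    using that g(3)[of t] \<open>d > 0\<close> by (simp add: g'_def ramp_1 D_def)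
  ultimately show ?case
    unfolding s' by blast
qed

lemma approximable_ridge:
  fixes h :: "real \<Rightarrow> real"
  assumes "bounded K" "continuous_on UNIV h"
  shows "approximable TeLU K (\<lambda>x. h (w \<bullet> x))"
proof (rule approximable_closed)
  fix \<epsilon> :: real
  assume "\<epsilon> > 0"
  obtain B where B: "\<And>x. x \<in> K \<Longrightarrow> norm x \<le> B" "B > 0"
    using assms(1) bounded_pos by blast
  \<comment> \<open>The added 1 keeps \<open>R\<close> positive when \<open>w = 0\<close>, so that
    the mesh width below is positive.\<close>
  define R where "R = norm w * B + 1"
  have "R > 0"
    using B by (auto simp: R_def intro: add_nonneg_pos)
  have R: "\<bar>w \<bullet> x\<bar> \<le> R" if "x \<in> K" for x
  proof -
    have "\<bar>w \<bullet> x\<bar> \<le> norm w * norm x"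
      by (rule Cauchy_Schwarz_ineq2)
    also have "\<dots> \<le> norm w * B"
      using B(1)[OF that] by (intro mult_left_mono) auto
    finally show ?thesis
      by (simp add: R_def)
  qed
  \<comment> \<open>The modulus is taken for \<open>\<epsilon> / 2\<close>, since interpolation
    doubles the bound on the oscillation.\<close>
  have "uniformly_continuous_on {-R..R} h"
    using assms(2) by (intro compact_uniformly_continuous) (auto intro: continuous_on_subset)
  then obtain \<delta> where \<delta>: "\<delta> > 0"
    "\<And>s t. s \<in> {-R..R} \<Longrightarrow> t \<in> {-R..R} \<Longrightarrow> \<bar>t - s\<bar> < \<delta> \<Longrightarrow> \<bar>h t - h s\<bar> < \<epsilon> / 2"
    using \<open>\<epsilon> > 0\<close> half_gt_zero[OF \<open>\<epsilon> > 0\<close>]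
    unfolding uniformly_continuous_on_def dist_real_def by metis
  obtain N :: nat where N: "2 * R / \<delta> < real N"
    using reals_Archimedean2 by blast
  then have "N > 0"
    using \<open>R > 0\<close> \<delta>(1) by (metis divide_pos_pos gr0I mult_pos_pos not_less_iff_gr_or_eq of_nat_0 zero_less_numeral)
  \<comment> \<open>\<open>N\<close> cells of this width cover \<open>{-R..R}\<close> exactly, and
    \<open>N\<close> was chosen to make the width less than \<delta>.\<close>
  define d where "d = 2 * R / real N"
  have d: "d > 0" "d < \<delta>" "real N * d = 2 * R"
    using \<open>N > 0\<close> \<open>R > 0\<close> N \<delta>(1) by (auto simp: d_def field_simps)
  have "\<exists>g. approximable TeLU K (\<lambda>x. g (w \<bullet> x)) \<and>
    (\<forall>t. -R \<le> t \<longrightarrow> t \<le> -R + real N * d \<longrightarrow> \<bar>g t - h t\<bar> \<le> 2 * (\<epsilon> / 2)) \<and>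
    (\<forall>t. -R + real N * d \<le> t \<longrightarrow> g t = h (-R + real N * d))"
  proof (rule approximable_interpolant)
    fix k t
    assume k: "k < N" and t: "-R + real k * d \<le> t" "t \<le> -R + real (Suc k) * d"
    have "real (Suc k) * d \<le> real N * d"
      using k d by (intro mult_right_mono) auto
    moreover have "0 \<le> real k * d"
      using d by simp
    moreover have "real (Suc k) * d = real k * d + d"
      by (simp add: algebra_simps)
    ultimately have "-R + real k * d \<in> {-R..R}" "t \<in> {-R..R}" "\<bar>t - (-R + real k * d)\<bar> < \<delta>"
      using t d unfolding atLeastAtMost_iff abs_less_iff by linarith+
    then have "\<bar>h t - h (-R + real k * d)\<bar> < \<epsilon> / 2"
      by (rule \<delta>(2))
    then show "\<bar>h t - h (-R + real k * d)\<bar> \<le> \<epsilon> / 2"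
      by simp
  qed (use d \<open>\<epsilon> > 0\<close> in auto)
  then obtain g where g: "approximable TeLU K (\<lambda>x. g (w \<bullet> x))"
    "\<And>t. -R \<le> t \<Longrightarrow> t \<le> R \<Longrightarrow> \<bar>g t - h t\<bar> \<le> \<epsilon>"
    using d(3) by auto
  have "\<bar>g (w \<bullet> x) - h (w \<bullet> x)\<bar> \<le> \<epsilon>" if "x \<in> K" for x
    using R[OF that] by (intro g(2)) auto
  with g(1) show "\<exists>g. approximable TeLU K g \<and> (\<forall>x\<in>K. \<bar>g x - h (w \<bullet> x)\<bar> \<le> \<epsilon>)"
    by blast
qed

section \<open>The algebra of exponential sums and Stone--Weierstrass\<close>

inductive exp_sum :: "('a::real_inner \<Rightarrow> real) \<Rightarrow> bool" where
  exp: "exp_sum (\<lambda>x. c * exp (w \<bullet> x))"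
| add: "exp_sum f \<Longrightarrow> exp_sum g \<Longrightarrow> exp_sum (\<lambda>x. f x + g x)"

text \<open>Exponents add, so a product of two generators is again a single exponential of a linear
  form; distributivity does the rest. Products of general ridge functions need not be ridge
  functions, which is why exponentials are used.\<close>

lemma exp_sum_mult:
  assumes "exp_sum f" "exp_sum g"
  shows "exp_sum (\<lambda>x. f x * g x)"
  using assms(1)
proof induction
  case (exp c w)
  show ?case
    using assms(2)
  proof induction
    case (exp c' w')
    show ?case
      using exp_sum.exp[of "c * c'" "w + w'"] by (simp add: inner_add_left exp_add mult_ac)
  qed (auto simp: distrib_left intro: exp_sum.add)
qed (auto simp: distrib_right intro: exp_sum.add)

lemma continuous_on_exp_sum: "exp_sum f \<Longrightarrow> continuous_on S f"
  by (induction rule: exp_sum.induct) (auto intro!: continuous_intros)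

lemma approximable_exp_sum: "exp_sum f \<Longrightarrow> bounded K \<Longrightarrow> approximable TeLU K f"
  by (induction rule: exp_sum.induct)
    (auto intro!: approximable_add approximable_cmult approximable_ridge continuous_intros)

lemma approximable_TeLU:
  assumes "compact K" "continuous_on K f"
  shows "approximable TeLU K f"
proof (rule approximable_closed)
  fix \<epsilon> :: real
  assume "\<epsilon> > 0"
  interpret function_ring_on "Collect exp_sum" K
  proof
    show "(\<lambda>_. c) \<in> Collect exp_sum" for c
      using exp_sum.exp[of c 0] by simp
    fix x y :: "real ^ 'a"
    assume "x \<noteq> y"
    \<comment> \<open>The direction \<open>x - y\<close> separates the points, the two inner
      products differing by its squared norm; injectivity of \<open>exp\<close> preserves
      this.\<close>
    then have "(x - y) \<bullet> x \<noteq> (x - y) \<bullet> y"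
      by (metis eq_iff_diff_eq_0 inner_diff_right inner_eq_zero_iff)
    then show "\<exists>f\<in>Collect exp_sum. f x \<noteq> f y"
      using exp_sum.exp[of 1 "x - y"] by (intro bexI[where x = "\<lambda>z. 1 * exp ((x - y) \<bullet> z)"]) auto
  qed (use assms in \<open>auto intro: continuous_on_exp_sum exp_sum.add exp_sum_mult\<close>)
  obtain g where "exp_sum g" "\<forall>x\<in>K. \<bar>f x - g x\<bar> < \<epsilon>"
    using Stone_Weierstrass_basic[OF assms(2) \<open>\<epsilon> > 0\<close>] by blast
  then show "\<exists>g. approximable TeLU K g \<and> (\<forall>x\<in>K. \<bar>g x - f x\<bar> \<le> \<epsilon>)"
    using approximable_exp_sum[OF _ compact_imp_bounded[OF assms(1)]]
    by (metis abs_minus_commute less_imp_le)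
qed

theorem theorem5p2:
  shows "(\<forall>(a::real) (b::real) (f :: real ^ 'n \<Rightarrow> real) (\<epsilon>::real).
            a < b \<longrightarrow> continuous_on (cbox (\<chi> i. a) (\<chi> i. b)) f \<longrightarrow> \<epsilon> > 0 \<longrightarrow>
            (\<exists>M \<alpha> w \<beta>. \<forall>x \<in> cbox (\<chi> i. a) (\<chi> i. b).
               \<bar>shallow_net TeLU M \<alpha> w \<beta> x - f x\<bar> < \<epsilon>))
       \<and> (\<forall>M \<alpha> (w :: nat \<Rightarrow> real ^ 'n) \<beta>. real_analytic (shallow_net TeLU M \<alpha> w \<beta>))"
  using approximable_TeLU[OF compact_cbox] real_analytic_shallow_net_TeLU
  unfolding approximable_def by blast

end
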